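(* Let $\phi_\ell(t)=t^\ell/\ell!$, $\ell=0,1,2,\dots$, be the scaled monomials and, for $N\ge 1$, let $H_N\in\mathbb{R}^{N\times N}$ be the matrix with ones on the first subdiagonal and zeros elsewhere. Let $\bar\phi_N(t)=[\phi_0(t),\dots,\phi_{N-1}(t)]^{\mathrm T}$ and $\bar\varepsilon_N(t)=\bar\phi_N(t)-\exp(tH_N)e_1$. Then $$\bar\varepsilon_N(t)\equiv 0 .$$ Consequently, with $u$ and $u_N$ as defined in the context (for this choice of basis functions, $w_\ell=g^{(\ell)}(0)$), the truncation error satisfies $\|u(t)-u_N(t)\|\to 0$ as $N\to\infty$ for every $t\ge 0$.
   Context: $\|\cdot\|$ is the Euclidean vector norm or spectral matrix norm, and $e_1$ is the first unit vector of consistent size. $A\in\mathbb{C}^{n\times n}$, $u_0\in\mathbb{C}^n$, and $g:\mathbb{C}\to\mathbb{C}^n$ has entire components. $u$ is the solution of $u'(t)=Au(t)+g(t)$, $u(0)=u_0$. The function $g$ is expanded as $g(s)=\sum_{\ell=0}^\infty w_\ell\phi_\ell(s)$ with $w_\ell\in\mathbb{C}^n$ (for the scaled monomials this is the Taylor expansion, $w_\ell=g^{(\ell)}(0)$). $W_N=[w_0\ \cdots\ w_{N-1}]\in\mathbb{C}^{n\times N}$, $$A_N=\begin{bmatrix}A&W_N\\0&H_N\end{bmatrix}\in\mathbb{C}^{(n+N)\times(n+N)},\qquad u_N(t)=\begin{bmatrix}I_n&0\end{bmatrix}\exp(tA_N)\begin{bmatrix}u_0\\ e_1\end{bmatrix}.$$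 *)

theory Defs
  imports "HOL-Complex_Analysis.Complex_Analysis" "Jordan_Normal_Form.Matrix"
begin

(* The size n + N has to vary inside the statement, so vectors and matrices are those of
   Jordan_Normal_Form.Matrix; the type-indexed ones of HOL-Analysis are hidden. *)
unbundle no vec_syntax
hide_type (open) Finite_Cartesian_Product.vec
hide_const (open) Finite_Cartesian_Product.vec Determinants.det Finite_Cartesian_Product.mat

(* All indices start at 0: unit_vec N 0 is e_1. *)

definition eucl_norm :: "complex vec \<Rightarrow> real" where
  "eucl_norm v = L2_set (\<lambda>i. cmod (v $ i)) {..<dim_vec v}"

(* The power series of exp M, summed entrywise; each entry converges absolutely for every
   square M. *)
definition mat_exp :: "complex mat \<Rightarrow> complex mat" where
  "mat_exp M = mat (dim_row M) (dim_row M)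
     (\<lambda>(i, j). \<Sum>k. (M ^\<^sub>m k) $$ (i, j) / fact k)"

definition scaled_monomial :: "nat \<Rightarrow> complex \<Rightarrow> complex" where
  "scaled_monomial l t = t ^ l / fact l"

definition monomial_vec :: "nat \<Rightarrow> complex \<Rightarrow> complex vec" where
  "monomial_vec N t = vec N (\<lambda>l. scaled_monomial l t)"

definition shift_mat :: "nat \<Rightarrow> complex mat" where
  "shift_mat N = mat N N (\<lambda>(i, j). if i = Suc j then 1 else 0)"

definition eps_vec :: "nat \<Rightarrow> complex \<Rightarrow> complex vec" where
  "eps_vec N t = monomial_vec N t - mat_exp (t \<cdot>\<^sub>m shift_mat N) *\<^sub>v unit_vec N 0"

definition entire_vec :: "nat \<Rightarrow> (complex \<Rightarrow> complex vec) \<Rightarrow> bool" where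
  "entire_vec n g \<longleftrightarrow>
     (\<forall>s. g s \<in> carrier_vec n) \<and> (\<forall>i<n. (\<lambda>s. g s $ i) holomorphic_on UNIV)"

(* The componentwise l-th derivative of g at 0. *)
definition taylor_coeff :: "nat \<Rightarrow> (complex \<Rightarrow> complex vec) \<Rightarrow> nat \<Rightarrow> complex vec" where
  "taylor_coeff n g l = vec n (\<lambda>i. (deriv ^^ l) (\<lambda>s. g s $ i) 0)"

definition coeff_mat :: "nat \<Rightarrow> (complex \<Rightarrow> complex vec) \<Rightarrow> nat \<Rightarrow> complex mat" where
  "coeff_mat n g N = mat_of_cols n (map (taylor_coeff n g) [0..<N])"

(* The equation is imposed on [0, \<infinity>), with the one-sided derivative at 0. *)
definition solves_ivp ::
  "nat \<Rightarrow> complex mat \<Rightarrow> (complex \<Rightarrow> complex vec) \<Rightarrow> complex vec \<Rightarrow> (real \<Rightarrow> complex vec) \<Rightarrow> bool"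
where
  "solves_ivp n A g u0 u \<longleftrightarrow>
     u 0 = u0 \<and>
     (\<forall>t\<ge>0. u t \<in> carrier_vec n \<and>
       (\<forall>i<n. ((\<lambda>s. u s $ i) has_vector_derivative
                 (A *\<^sub>v u t + g (complex_of_real t)) $ i) (at t within {0..})))"

definition ext_mat :: "nat \<Rightarrow> complex mat \<Rightarrow> (complex \<Rightarrow> complex vec) \<Rightarrow> nat \<Rightarrow> complex mat" where
  "ext_mat n A g N =
     four_block_mat A (coeff_mat n g N) (0\<^sub>m N n) (shift_mat N)"

(* vec_first v n is [I_n 0] v. *)
definition trunc_sol ::
  "nat \<Rightarrow> complex mat \<Rightarrow> (complex \<Rightarrow> complex vec) \<Rightarrow> complex vec \<Rightarrow> nat \<Rightarrow> real \<Rightarrow> complex vec"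
where
  "trunc_sol n A g u0 N t =
     vec_first (mat_exp (complex_of_real t \<cdot>\<^sub>m ext_mat n A g N) *\<^sub>v (u0 @\<^sub>v unit_vec N 0)) n"

end

theory Submission
  imports Defs
begin

text \<open>
  Everything rests on the curves \<open>t \<mapsto> exp (t M) v\<close>. Entrywise they are power series with
  coefficients \<open>(M\<^sup>k v)\<^sub>i / k!\<close>, so termwise differentiation shows that they solve \<open>y' = M y\<close>
  (\<open>has_field_derivative_mat_exp_mult_vec\<close>).

  The shift matrix \<open>H\<^sub>N\<close> moves each unit vector to the next one and finally to zero. Hence the
  \<open>i\<close>-th entry of \<open>exp (t H\<^sub>N) e\<^sub>1\<close> receives the \<open>i\<close>-th term of the series only, and that term is
  \<open>t\<^sup>i / i!\<close>. The vanishing of \<open>eps_vec\<close> says exactly this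
  (\<open>mat_exp_shift_mat_unit_vec\<close>).

  As the extended matrix is block upper triangular, the lower block of its exponential curve
  evolves under \<open>H\<^sub>N\<close> alone and is therefore the vector of scaled monomials. The upper block
  \<open>u\<^sub>N\<close> then solves \<open>u\<^sub>N' = A u\<^sub>N + g\<^sub>N\<close>, \<open>u\<^sub>N(0) = u\<^sub>0\<close>, where \<open>g\<^sub>N\<close> is the \<open>N\<close>-th Taylor
  partial sum of \<open>g\<close> (\<open>trunc_sol_has_vector_derivative\<close>). So the error \<open>d = u - u\<^sub>N\<close> starts at
  zero and solves \<open>d' = A d + (g - g\<^sub>N)\<close>. A Gronwall estimate for \<open>\<parallel>d\<parallel>\<^sup>2\<close> bounds the error at
  time \<open>T\<close> by a constant independent of \<open>N\<close> times the supremum of \<open>\<parallel>g - g\<^sub>N\<parallel>\<close> on \<open>[0, T]\<close>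
  (\<open>linear_ode_energy_bound\<close>), and this supremum tends to zero because the Taylor series of an
  entire function converges uniformly on discs (\<open>entire_taylor_uniform_limit\<close>).
\<close>

(* The dollar sign would otherwise also denote coefficients of formal power series, and the number
   of parses of a chain of vector entries would grow exponentially. *)
unbundle no Formal_Power_Series.fps_syntax

section \<open>The exponential series applied to a vector\<close>

lemma pow_mat_Suc_left:
  fixes M :: "'a :: semiring_1 mat"
  assumes "M \<in> carrier_mat m m"
  shows "M ^\<^sub>m Suc k = M * M ^\<^sub>m k"
proof (induction k)
  case 0
  then show ?case using assms by simp
next
  case (Suc k)
  have "M ^\<^sub>m Suc (Suc k) = (M * M ^\<^sub>m k) * M"
    using Suc by simp
  also have "\<dots> = M * (M ^\<^sub>m k * M)"
    using assms by (intro assoc_mult_mat[of _ m m _ m _ m]) (auto intro: pow_carrier_mat)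
  finally show ?case by simp
qed

lemma pow_mat_smult:
  fixes M :: "'a :: comm_semiring_1 mat"
  assumes M: "M \<in> carrier_mat m m"
  shows "(c \<cdot>\<^sub>m M) ^\<^sub>m k = c ^ k \<cdot>\<^sub>m M ^\<^sub>m k"
proof (induction k)
  case 0
  then show ?case using M by (auto intro!: eq_matI)
next
  case (Suc k)
  have P: "M ^\<^sub>m k \<in> carrier_mat m m"
    using M by (rule pow_carrier_mat)
  have "(c \<cdot>\<^sub>m M) ^\<^sub>m Suc k = (c ^ k \<cdot>\<^sub>m M ^\<^sub>m k) * (c \<cdot>\<^sub>m M)"
    using Suc by simp
  also have "\<dots> = c ^ Suc k \<cdot>\<^sub>m (M ^\<^sub>m k * M)"
    using M P by (intro eq_matI) (auto simp: scalar_prod_def sum_distrib_left mult_ac intro!: sum.cong)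
  finally show ?case by simp
qed

lemma pow_mat_mult_vec_Suc:
  fixes M :: "'a :: comm_semiring_1 mat"
  assumes M: "M \<in> carrier_mat m m" and v: "v \<in> carrier_vec m"
  shows "M ^\<^sub>m Suc k *\<^sub>v v = M *\<^sub>v (M ^\<^sub>m k *\<^sub>v v)"
  unfolding pow_mat_Suc_left[OF M]
  by (rule assoc_mult_mat_vec[OF M pow_carrier_mat[OF M] v])

text \<open>
  The sum of the moduli of all entries dominates every row sum, so the bound propagates through
  one more factor. It makes the entries of the exponential series converge absolutely.
\<close>

lemma cmod_pow_mat_entry_le:
  fixes M :: "complex mat"
  assumes M: "M \<in> carrier_mat m m" and "i < m" "j < m"
  shows "cmod ((M ^\<^sub>m k) $$ (i, j)) \<le> (\<Sum>p<m. \<Sum>q<m. cmod (M $$ (p, q))) ^ k"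
  using \<open>i < m\<close>
proof (induction k arbitrary: i)
  case 0
  then show ?case using M \<open>j < m\<close> by simp
next
  case (Suc k)
  let ?b = "\<Sum>p<m. \<Sum>q<m. cmod (M $$ (p, q))"
  have P: "M ^\<^sub>m k \<in> carrier_mat m m"
    using M by (rule pow_carrier_mat)
  have b: "0 \<le> ?b" by (intro sum_nonneg) auto
  have "(M ^\<^sub>m Suc k) $$ (i, j) = (\<Sum>q<m. M $$ (i, q) * (M ^\<^sub>m k) $$ (q, j))"
    unfolding pow_mat_Suc_left[OF M] using M P Suc.prems \<open>j < m\<close>
    by (simp add: scalar_prod_def atLeast0LessThan)
  also have "cmod \<dots> \<le> (\<Sum>q<m. cmod (M $$ (i, q)) * ?b ^ k)"
    using Suc.IH by (intro sum_norm_le) (auto simp: norm_mult intro!: mult_left_mono)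
  also have "\<dots> = (\<Sum>q<m. cmod (M $$ (i, q))) * ?b ^ k"
    by (simp add: sum_distrib_right)
  also have "\<dots> \<le> ?b * ?b ^ k"
    using Suc.prems b
    by (intro mult_right_mono member_le_sum[where f = "\<lambda>p. \<Sum>q<m. cmod (M $$ (p, q))"])
       (auto intro: sum_nonneg)
  finally show ?case by simp
qed

text \<open>
  The exponential is defined entry by entry, as one series per entry. Each of them converges by
  comparison with a scalar exponential, and the finite sum over the columns can then be
  taken inside the series. This form, a power series in \<open>t\<close> with coefficients free of \<open>t\<close>,
  is the one that termwise differentiation needs.
\<close>

lemma mat_exp_smult_mult_vec_sums:
  assumes M: "M \<in> carrier_mat m m" and v: "v \<in> carrier_vec m" and i: "i < m"
  shows "(\<lambda>k. (M ^\<^sub>m k *\<^sub>v v) $ i / fact k * t ^ k) sums ((mat_exp (t \<cdot>\<^sub>m M) *\<^sub>v v) $ i)"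
proof -
  have P: "M ^\<^sub>m k \<in> carrier_mat m m" for k
    using M by (rule pow_carrier_mat)
  define b where "b = (\<Sum>p<m. \<Sum>q<m. cmod (M $$ (p, q)))"
  have entry: "((t \<cdot>\<^sub>m M) ^\<^sub>m k) $$ (i, j) / fact k = t ^ k * (M ^\<^sub>m k) $$ (i, j) / fact k"
    if "j < m" for j k
    unfolding pow_mat_smult[OF M] using that i P[of k] by (subst index_smult_mat) auto
  have summ: "summable (\<lambda>k. t ^ k * (M ^\<^sub>m k) $$ (i, j) / fact k)" if j: "j < m" for j
  proof (rule summable_comparison_test')
    show "summable (\<lambda>k. (cmod t * b) ^ k / fact k)"
      using summable_exp[of "cmod t * b"] by (simp add: field_simps)
    show "norm (t ^ k * (M ^\<^sub>m k) $$ (i, j) / fact k) \<le> (cmod t * b) ^ k / fact k" for k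
      using cmod_pow_mat_entry_le[OF M i j, of k]
      by (auto simp: norm_divide norm_mult norm_power power_mult_distrib b_def
               intro!: divide_right_mono mult_left_mono)
  qed
  have "(\<lambda>k. \<Sum>j<m. t ^ k * (M ^\<^sub>m k) $$ (i, j) / fact k * v $ j) sums
        (\<Sum>j<m. (\<Sum>k. t ^ k * (M ^\<^sub>m k) $$ (i, j) / fact k) * v $ j)"
    by (intro sums_sum sums_mult2 summable_sums summ) auto
  also have "(\<lambda>k. \<Sum>j<m. t ^ k * (M ^\<^sub>m k) $$ (i, j) / fact k * v $ j) =
             (\<lambda>k. (M ^\<^sub>m k *\<^sub>v v) $ i / fact k * t ^ k)"
    using v i P M
    by (auto simp: fun_eq_iff scalar_prod_def atLeast0LessThan sum_divide_distrib
        sum_distrib_left sum_distrib_right mult_ac intro!: sum.cong)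
  also have "(\<Sum>j<m. (\<Sum>k. t ^ k * (M ^\<^sub>m k) $$ (i, j) / fact k) * v $ j) =
             (mat_exp (t \<cdot>\<^sub>m M) *\<^sub>v v) $ i"
    using v i M by (simp add: mat_exp_def scalar_prod_def atLeast0LessThan entry)
  finally show ?thesis .
qed

text \<open>
  Differentiating the series termwise turns \<open>M\<^sup>k v / k!\<close> into \<open>M\<^sup>k\<^sup>+\<^sup>1 v / k!\<close>, and a factor
  \<open>M\<close> can be pulled out on the left because it commutes with its powers.
\<close>

lemma has_field_derivative_mat_exp_mult_vec:
  assumes M: "M \<in> carrier_mat m m" and v: "v \<in> carrier_vec m" and i: "i < m"
  shows "((\<lambda>t. (mat_exp (t \<cdot>\<^sub>m M) *\<^sub>v v) $ i) has_field_derivative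
           (M *\<^sub>v (mat_exp (t \<cdot>\<^sub>m M) *\<^sub>v v)) $ i) (at t)"
proof -
  define c where "c j k = (M ^\<^sub>m k *\<^sub>v v) $ j / fact k" for j k
  have S: "(\<lambda>k. c j k * s ^ k) sums ((mat_exp (s \<cdot>\<^sub>m M) *\<^sub>v v) $ j)" if "j < m" for j s
    unfolding c_def by (rule mat_exp_smult_mult_vec_sums[OF M v that])
  have "((\<lambda>s. \<Sum>k. c i k * s ^ k) has_field_derivative (\<Sum>k. diffs (c i) k * t ^ k)) (at t)"
    by (rule termdiffs_strong_converges_everywhere) (rule sums_summable[OF S[OF i]])
  moreover have "(\<lambda>s. \<Sum>k. c i k * s ^ k) = (\<lambda>t. (mat_exp (t \<cdot>\<^sub>m M) *\<^sub>v v) $ i)"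
    using S[OF i] by (auto simp: sums_iff)
  moreover have "(\<Sum>k. diffs (c i) k * t ^ k) = (M *\<^sub>v (mat_exp (t \<cdot>\<^sub>m M) *\<^sub>v v)) $ i"
  proof -
    have "diffs (c i) k * t ^ k = (\<Sum>j<m. M $$ (i, j) * (c j k * t ^ k))" for k
    proof -
      have "diffs (c i) k = (M ^\<^sub>m Suc k *\<^sub>v v) $ i / fact k"
        unfolding diffs_def c_def
        by (simp add: field_simps del: of_nat_Suc pow_mat.simps)
      also have "(M ^\<^sub>m Suc k *\<^sub>v v) $ i = (\<Sum>j<m. M $$ (i, j) * (M ^\<^sub>m k *\<^sub>v v) $ j)"
        unfolding pow_mat_mult_vec_Suc[OF M v] using M v i pow_carrier_mat[OF M, of k]
        by (subst index_mult_mat_vec) (auto simp: scalar_prod_def atLeast0LessThan)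
      finally have "diffs (c i) k = (\<Sum>j<m. M $$ (i, j) * c j k)"
        by (simp add: c_def[of _ k] sum_divide_distrib)
      thus ?thesis by (simp add: sum_distrib_left mult_ac)
    qed
    moreover have "(\<lambda>k. \<Sum>j<m. M $$ (i, j) * (c j k * t ^ k)) sums
        (\<Sum>j<m. M $$ (i, j) * (mat_exp (t \<cdot>\<^sub>m M) *\<^sub>v v) $ j)"
      by (intro sums_sum sums_mult S) auto
    moreover have "(\<Sum>j<m. M $$ (i, j) * (mat_exp (t \<cdot>\<^sub>m M) *\<^sub>v v) $ j) =
        (M *\<^sub>v (mat_exp (t \<cdot>\<^sub>m M) *\<^sub>v v)) $ i"
      using M i by (subst index_mult_mat_vec) (auto simp: scalar_prod_def atLeast0LessThan mat_exp_def)
    ultimately show ?thesis by (simp add: sums_iff)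
  qed
  ultimately show ?thesis by simp
qed

lemma mat_exp_carrier: "M \<in> carrier_mat m m \<Longrightarrow> mat_exp M \<in> carrier_mat m m"
  by (auto simp: mat_exp_def)

lemma mat_exp_0_mult_vec:
  assumes M: "M \<in> carrier_mat m m" and v: "v \<in> carrier_vec m"
  shows "mat_exp (0 \<cdot>\<^sub>m M) *\<^sub>v v = v"
proof (rule eq_vecI)
  fix i assume "i < dim_vec v"
  hence i: "i < m" using v by simp
  have "(\<lambda>k. (M ^\<^sub>m k *\<^sub>v v) $ i / fact k * 0 ^ k) sums ((M ^\<^sub>m 0 *\<^sub>v v) $ i)"
    using powser_sums_zero[of "\<lambda>k. (M ^\<^sub>m k *\<^sub>v v) $ i / fact k"] by simp
  with mat_exp_smult_mult_vec_sums[OF M v i, of 0]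
  have "(mat_exp (0 \<cdot>\<^sub>m M) *\<^sub>v v) $ i = (M ^\<^sub>m 0 *\<^sub>v v) $ i"
    by (rule sums_unique2)
  thus "(mat_exp (0 \<cdot>\<^sub>m M) *\<^sub>v v) $ i = v $ i" using M v by simp
qed (use M v in \<open>auto simp: mat_exp_def\<close>)

section \<open>The shift matrix and the extended system\<close>

lemma shift_mat_pow_unit_vec:
  "shift_mat N ^\<^sub>m k *\<^sub>v unit_vec N 0 = vec N (\<lambda>i. if i = k then 1 else 0)"
proof (induction k)
  case 0
  show ?case by (auto simp: shift_mat_def unit_vec_def)
next
  case (Suc k)
  have H: "shift_mat N \<in> carrier_mat N N" by (simp add: shift_mat_def)
  have "shift_mat N ^\<^sub>m Suc k *\<^sub>v unit_vec N 0 = shift_mat N *\<^sub>v vec N (\<lambda>i. if i = k then 1 else 0)"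
    by (subst pow_mat_mult_vec_Suc[OF H]) (simp_all only: Suc unit_vec_carrier)
  also have "\<dots> = vec N (\<lambda>i. if i = Suc k then 1 else 0)"
  proof (rule eq_vecI)
    fix i assume "i < dim_vec (vec N (\<lambda>i. if i = Suc k then 1 else 0 :: complex))"
    hence i: "i < N" by simp
    have "(shift_mat N *\<^sub>v vec N (\<lambda>i. if i = k then 1 else 0)) $ i =
          (\<Sum>j<N. (if i = Suc j then 1 else 0) * (if j = k then 1 else 0))"
      using i by (simp add: shift_mat_def scalar_prod_def atLeast0LessThan)
    also have "\<dots> = (\<Sum>j<N. if j = k then if i = Suc k then 1 else 0 else 0)"
      by (intro sum.cong) auto
    also have "\<dots> = (if i = Suc k then 1 else 0)"
      using i by auto
    finally show "(shift_mat N *\<^sub>v vec N (\<lambda>i. if i = k then 1 else 0)) $ i =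
        vec N (\<lambda>i. if i = Suc k then 1 else 0) $ i" using i by simp
  qed (simp add: shift_mat_def)
  finally show ?case .
qed

text \<open>
  The series that the exponential curve contributes to entry \<open>l\<close> when only its \<open>l\<close>-th term
  is nonzero there.
\<close>

lemma power_series_single_coeff_sums:
  "(\<lambda>k. (if l = k then 1 else 0) / fact k * t ^ k) sums scaled_monomial l t"
proof -
  have "(\<lambda>k. if k = l then t ^ k / fact k else 0) sums (t ^ l / fact l)"
    by (rule sums_single)
  also have "(\<lambda>k. if k = l then t ^ k / fact k else 0) =
      (\<lambda>k. (if l = k then 1 else 0) / fact k * t ^ k)"
    by auto
  finally show ?thesis by (simp add: scaled_monomial_def)
qed

lemma mat_exp_shift_mat_unit_vec:
  "mat_exp (t \<cdot>\<^sub>m shift_mat N) *\<^sub>v unit_vec N 0 = monomial_vec N t"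
proof (rule eq_vecI)
  have H: "shift_mat N \<in> carrier_mat N N" by (simp add: shift_mat_def)
  fix i assume "i < dim_vec (monomial_vec N t)"
  hence i: "i < N" by (simp add: monomial_vec_def)
  have "(\<lambda>k. (if i = k then 1 else 0) / fact k * t ^ k) sums
      ((mat_exp (t \<cdot>\<^sub>m shift_mat N) *\<^sub>v unit_vec N 0) $ i)"
    using mat_exp_smult_mult_vec_sums[OF H unit_vec_carrier i, of 0 t] i
    by (simp add: shift_mat_pow_unit_vec)
  thus "(mat_exp (t \<cdot>\<^sub>m shift_mat N) *\<^sub>v unit_vec N 0) $ i = monomial_vec N t $ i"
    using sums_unique2[OF power_series_single_coeff_sums] i by (simp add: monomial_vec_def)
qed (simp add: mat_exp_def shift_mat_def monomial_vec_def)

lemma block_upper_triangular_mult_vec_last: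
  fixes A B D :: "'a :: comm_semiring_1 mat"
  assumes A: "A \<in> carrier_mat n n" and B: "B \<in> carrier_mat n m" and D: "D \<in> carrier_mat m m"
    and v: "v \<in> carrier_vec (n + m)"
  shows "four_block_mat A B (0\<^sub>m m n) D *\<^sub>v v =
    (A *\<^sub>v vec_first v n + B *\<^sub>v vec_last v m) @\<^sub>v (D *\<^sub>v vec_last v m)"
proof -
  have "four_block_mat A B (0\<^sub>m m n) D *\<^sub>v (vec_first v n @\<^sub>v vec_last v m) =
    (A *\<^sub>v vec_first v n + B *\<^sub>v vec_last v m) @\<^sub>v (0\<^sub>m m n *\<^sub>v vec_first v n + D *\<^sub>v vec_last v m)"
    by (rule four_block_mat_mult_vec[OF A B _ D]) auto
  moreover have "0\<^sub>m m n *\<^sub>v vec_first v n + D *\<^sub>v vec_last v m = D *\<^sub>v vec_last v m"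
    using D by (intro eq_vecI) (auto simp: scalar_prod_def)
  ultimately show ?thesis using v by simp
qed

lemma coeff_mat_carrier: "coeff_mat n g N \<in> carrier_mat n N"
  unfolding coeff_mat_def
  using mat_of_cols_carrier(1)[of n "map (taylor_coeff n g) [0..<N]"] by simp

lemma shift_mat_carrier: "shift_mat N \<in> carrier_mat N N"
  by (simp add: shift_mat_def)

lemma ext_mat_carrier:
  "A \<in> carrier_mat n n \<Longrightarrow> ext_mat n A g N \<in> carrier_mat (n + N) (n + N)"
  unfolding ext_mat_def by (rule four_block_carrier_mat[OF _ shift_mat_carrier])

lemma vec_last_append:
  "w \<in> carrier_vec m \<Longrightarrow> vec_last (v @\<^sub>v w) m = w"
  by (intro eq_vecI) (auto simp: vec_last_def)

lemma vec_first_append: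
  "v \<in> carrier_vec n \<Longrightarrow> vec_first (v @\<^sub>v w) n = v"
  by (intro eq_vecI) (auto simp: vec_first_def)

text \<open>
  The zero block makes the lower parts of the powers \<open>A\<^sub>N\<^sup>k [u\<^sub>0; e\<^sub>1]\<close> equal to \<open>H\<^sub>N\<^sup>k e\<^sub>1\<close>,
  so the lower part of the curve has the same power series as \<open>exp (t H\<^sub>N) e\<^sub>1\<close>.
\<close>

lemma vec_last_mat_exp_ext_mat:
  assumes A: "A \<in> carrier_mat n n" and u0: "u0 \<in> carrier_vec n"
  shows "vec_last (mat_exp (t \<cdot>\<^sub>m ext_mat n A g N) *\<^sub>v (u0 @\<^sub>v unit_vec N 0)) N = monomial_vec N t"
proof (rule eq_vecI)
  let ?E = "ext_mat n A g N" and ?x = "u0 @\<^sub>v unit_vec N 0 :: complex vec"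
  have E: "?E \<in> carrier_mat (n + N) (n + N)" by (rule ext_mat_carrier[OF A])
  have x: "?x \<in> carrier_vec (n + N)" using u0 by auto
  have pow: "vec_last (?E ^\<^sub>m k *\<^sub>v ?x) N = shift_mat N ^\<^sub>m k *\<^sub>v unit_vec N 0" for k
  proof (induction k)
    case 0
    show ?case using E x shift_mat_carrier[of N] by (simp add: vec_last_append)
  next
    case (Suc k)
    have y: "?E ^\<^sub>m k *\<^sub>v ?x \<in> carrier_vec (n + N)"
      by (rule mult_mat_vec_carrier[OF pow_carrier_mat[OF E] x])
    have "vec_last (?E *\<^sub>v (?E ^\<^sub>m k *\<^sub>v ?x)) N = shift_mat N *\<^sub>v vec_last (?E ^\<^sub>m k *\<^sub>v ?x) N"
      using block_upper_triangular_mult_vec_last[OF A coeff_mat_carrier shift_mat_carrier y]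
      by (simp add: ext_mat_def vec_last_append mult_mat_vec_carrier[OF shift_mat_carrier])
    then show ?case
      unfolding pow_mat_mult_vec_Suc[OF E x] pow_mat_mult_vec_Suc[OF shift_mat_carrier unit_vec_carrier]
      using Suc by simp
  qed
  fix i assume "i < dim_vec (monomial_vec N t)"
  hence i: "i < N" by (simp add: monomial_vec_def)
  have last: "vec_last v N $ i = v $ (n + i)" if "v \<in> carrier_vec (n + N)" for v :: "complex vec"
    using that i by (simp add: vec_last_def)
  have "(?E ^\<^sub>m k *\<^sub>v ?x) $ (n + i) = (if i = k then 1 else 0)" for k
    using last[OF mult_mat_vec_carrier[OF pow_carrier_mat[OF E] x]] i
    by (simp add: pow shift_mat_pow_unit_vec)
  hence "(\<lambda>k. (if i = k then 1 else 0) / fact k * t ^ k) sums ((mat_exp (t \<cdot>\<^sub>m ?E) *\<^sub>v ?x) $ (n + i))"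
    using mat_exp_smult_mult_vec_sums[OF E x, of "n + i" t] i by simp
  hence "(mat_exp (t \<cdot>\<^sub>m ?E) *\<^sub>v ?x) $ (n + i) = scaled_monomial i t"
    by (rule sums_unique2[OF _ power_series_single_coeff_sums])
  moreover have "mat_exp (t \<cdot>\<^sub>m ?E) *\<^sub>v ?x \<in> carrier_vec (n + N)"
    using mat_exp_carrier[OF smult_carrier_mat[OF E]] x by (rule mult_mat_vec_carrier)
  ultimately show "vec_last (mat_exp (t \<cdot>\<^sub>m ?E) *\<^sub>v ?x) N $ i = monomial_vec N t $ i"
    using last i by (simp add: monomial_vec_def)
qed (simp add: monomial_vec_def)

text \<open>
  The upper block row of \<open>y' = A\<^sub>N y\<close>: since the lower part of \<open>y\<close> consists of the scaled
  monomials, the coupling block turns it into a Taylor partial sum of \<open>g\<close>.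
\<close>

lemma trunc_sol_has_vector_derivative:
  assumes A: "A \<in> carrier_mat n n" and u0: "u0 \<in> carrier_vec n" and i: "i < n"
  shows "((\<lambda>s. trunc_sol n A g u0 N s $ i) has_vector_derivative
    (A *\<^sub>v trunc_sol n A g u0 N t) $ i +
      (\<Sum>l<N. taylor_coeff n g l $ i * scaled_monomial l (of_real t))) (at t)"
proof -
  let ?E = "ext_mat n A g N" and ?x = "u0 @\<^sub>v unit_vec N 0 :: complex vec"
  define y where "y s = mat_exp (s \<cdot>\<^sub>m ?E) *\<^sub>v ?x" for s
  have E: "?E \<in> carrier_mat (n + N) (n + N)" by (rule ext_mat_carrier[OF A])
  have x: "?x \<in> carrier_vec (n + N)" using u0 by auto
  have y: "y s \<in> carrier_vec (n + N)" for s
    unfolding y_def using mat_exp_carrier[OF smult_carrier_mat[OF E]] x by (rule mult_mat_vec_carrier)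
  have first: "trunc_sol n A g u0 N s = vec_first (y (of_real s)) n" for s
    by (simp add: trunc_sol_def y_def)
  have "((\<lambda>s. y s $ i) has_field_derivative (?E *\<^sub>v y (of_real t)) $ i) (at (of_real t))"
    unfolding y_def using i by (intro has_field_derivative_mat_exp_mult_vec[OF E x]) simp
  hence "((\<lambda>s. y (of_real s) $ i) has_vector_derivative (?E *\<^sub>v y (of_real t)) $ i) (at t)"
    by (rule has_vector_derivative_real_field)
  moreover have "(\<lambda>s. y (of_real s) $ i) = (\<lambda>s. trunc_sol n A g u0 N s $ i)"
    using i by (simp add: first vec_first_def)
  moreover have "(?E *\<^sub>v y (of_real t)) $ i = (A *\<^sub>v trunc_sol n A g u0 N t) $ i +
      (coeff_mat n g N *\<^sub>v monomial_vec N (of_real t)) $ i"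
  proof -
    have "vec_last (y (of_real t)) N = monomial_vec N (of_real t)"
      unfolding y_def by (rule vec_last_mat_exp_ext_mat[OF A u0])
    thus ?thesis
      using block_upper_triangular_mult_vec_last[OF A coeff_mat_carrier shift_mat_carrier y, of g] i A
        coeff_mat_carrier[of n g N]
      by (simp add: ext_mat_def first)
  qed
  moreover have "(coeff_mat n g N *\<^sub>v monomial_vec N (of_real t)) $ i =
      (\<Sum>l<N. taylor_coeff n g l $ i * scaled_monomial l (of_real t))"
    using i by (auto simp: coeff_mat_def monomial_vec_def scalar_prod_def atLeast0LessThan
        mat_of_cols_index intro!: sum.cong)
  ultimately show ?thesis by simp
qed

lemma trunc_sol_0:
  assumes "A \<in> carrier_mat n n" and "u0 \<in> carrier_vec n"
  shows "trunc_sol n A g u0 N 0 = u0"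
proof -
  have "mat_exp (0 \<cdot>\<^sub>m ext_mat n A g N) *\<^sub>v (u0 @\<^sub>v unit_vec N 0) = u0 @\<^sub>v unit_vec N 0"
    using assms by (intro mat_exp_0_mult_vec[OF ext_mat_carrier]) auto
  thus ?thesis
    unfolding trunc_sol_def of_real_0 by (simp only: vec_first_append[OF assms(2)])
qed

section \<open>Stability of linear systems and convergence of the truncation\<close>

text \<open>
  Gronwall's argument for the energy \<open>e = \<Sum> |d\<^sub>i|\<^sup>2\<close>. Splitting every mixed product by
  \<open>2 x y \<le> x\<^sup>2 + y\<^sup>2\<close> gives \<open>e' \<le> c e + \<delta>\<close>, so that \<open>exp (- c t) e(t) - \<delta> t\<close> is nonincreasing.
  Squared norms are used because they stay differentiable where \<open>d\<close> vanishes.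
\<close>

lemma linear_ode_energy_bound:
  fixes a :: "'i \<Rightarrow> 'i \<Rightarrow> complex" and d r :: "'i \<Rightarrow> real \<Rightarrow> complex"
  assumes fin: "finite I" and T: "0 \<le> T"
    and d: "\<And>i t. i \<in> I \<Longrightarrow> t \<in> {0..T} \<Longrightarrow>
      (d i has_vector_derivative (\<Sum>j\<in>I. a i j * d j t) + r i t) (at t within {0..T})"
    and d0: "\<And>i. i \<in> I \<Longrightarrow> d i 0 = 0"
    and r: "\<And>t. t \<in> {0..T} \<Longrightarrow> (\<Sum>i\<in>I. (cmod (r i t))\<^sup>2) \<le> \<delta>"
  shows "(\<Sum>i\<in>I. (cmod (d i T))\<^sup>2) \<le> \<delta> * T * exp ((2 * (\<Sum>i\<in>I. \<Sum>j\<in>I. cmod (a i j)) + 1) * T)"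
proof -
  define b where "b = (\<Sum>i\<in>I. \<Sum>j\<in>I. cmod (a i j))"
  define c where "c = 2 * b + 1"
  define e where "e t = (\<Sum>i\<in>I. (cmod (d i t))\<^sup>2)" for t
  define e' where "e' t = (\<Sum>i\<in>I. 2 * (d i t \<bullet> ((\<Sum>j\<in>I. a i j * d j t) + r i t)))" for t
  have b0: "0 \<le> b" unfolding b_def by (intro sum_nonneg) auto
  have deriv: "(e has_real_derivative e' t) (at t within {0..T})" if t: "t \<in> {0..T}" for t
  proof -
    have "((\<lambda>s. \<Sum>i\<in>I. d i s \<bullet> d i s) has_vector_derivative e' t) (at t within {0..T})"
      unfolding e'_def
    proof (rule has_vector_derivative_sum)
      fix i assume "i \<in> I"
      from bounded_bilinear.has_vector_derivative[OF bounded_bilinear_inner d[OF this t] d[OF this t]]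
      show "((\<lambda>s. d i s \<bullet> d i s) has_vector_derivative
              2 * (d i t \<bullet> ((\<Sum>j\<in>I. a i j * d j t) + r i t))) (at t within {0..T})"
        by (simp add: inner_commute)
    qed
    thus ?thesis
      by (simp add: has_real_derivative_iff_has_vector_derivative e_def[abs_def] power2_norm_eq_inner)
  qed
  have bound: "e' t \<le> c * e t + \<delta>" if t: "t \<in> {0..T}" for t
  proof -
    have term_le: "2 * (x * y) \<le> x\<^sup>2 + y\<^sup>2" for x y :: real
      using sum_squares_bound[of x y] by simp
    have "2 * (d i t \<bullet> ((\<Sum>j\<in>I. a i j * d j t) + r i t)) \<le>
        (\<Sum>j\<in>I. cmod (a i j)) * (2 * e t) + ((cmod (d i t))\<^sup>2 + (cmod (r i t))\<^sup>2)" if i: "i \<in> I" for i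
    proof -
      have mem: "(cmod (d j t))\<^sup>2 \<le> e t" if "j \<in> I" for j
        unfolding e_def using fin that by (intro member_le_sum) auto
      have "d i t \<bullet> (a i j * d j t) \<le> cmod (a i j) * e t" if j: "j \<in> I" for j
      proof -
        have "d i t \<bullet> (a i j * d j t) \<le> cmod (a i j) * (cmod (d i t) * cmod (d j t))"
          using norm_cauchy_schwarz[of "d i t" "a i j * d j t"] by (simp add: norm_mult mult_ac)
        also have "\<dots> \<le> cmod (a i j) * e t"
          using term_le[of "cmod (d i t)" "cmod (d j t)"] mem[OF i] mem[OF j]
          by (intro mult_left_mono) auto
        finally show ?thesis .
      qed
      hence "(\<Sum>j\<in>I. d i t \<bullet> (a i j * d j t)) \<le> (\<Sum>j\<in>I. cmod (a i j)) * e t"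
        unfolding sum_distrib_right by (intro sum_mono)
      moreover have "2 * (d i t \<bullet> r i t) \<le> (cmod (d i t))\<^sup>2 + (cmod (r i t))\<^sup>2"
        using norm_cauchy_schwarz[of "d i t" "r i t"] term_le[of "cmod (d i t)" "cmod (r i t)"] by linarith
      ultimately show ?thesis
        by (simp add: inner_add_right inner_sum_right algebra_simps)
    qed
    hence "e' t \<le> (\<Sum>i\<in>I. (\<Sum>j\<in>I. cmod (a i j)) * (2 * e t) + ((cmod (d i t))\<^sup>2 + (cmod (r i t))\<^sup>2))"
      unfolding e'_def by (rule sum_mono)
    also have "\<dots> = c * e t + (\<Sum>i\<in>I. (cmod (r i t))\<^sup>2)"
      by (simp add: sum.distrib c_def b_def e_def sum_distrib_right[symmetric] distrib_right)
    finally show ?thesis using r[OF t] by simp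
  qed
  define h where "h t = exp (- c * t) * e t - \<delta> * t" for t
  have h': "(h has_real_derivative exp (- c * t) * (e' t - c * e t) - \<delta>) (at t within {0..T})"
    if "t \<in> {0..T}" for t
    unfolding h_def[abs_def] using deriv[OF that]
    by (auto intro!: derivative_eq_intros simp: algebra_simps)
  have "h T \<le> h 0"
  proof (rule DERIV_nonpos_imp_decreasing_open[OF T])
    show "continuous_on {0..T} h"
      by (rule DERIV_continuous_on[OF h'])
    fix t assume t: "0 < t" "t < T"
    have \<delta>: "0 \<le> \<delta>"
      using r[of t] t sum_nonneg[of I "\<lambda>i. (cmod (r i t))\<^sup>2"] by simp
    have "exp (- c * t) * (e' t - c * e t) \<le> exp (- c * t) * \<delta>"
      using bound[of t] t by (intro mult_left_mono) auto
    also have "\<dots> \<le> 1 * \<delta>"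
      using \<delta> b0 t by (intro mult_right_mono) (auto simp: c_def mult_nonpos_nonneg)
    finally have "exp (- c * t) * (e' t - c * e t) - \<delta> \<le> 0" by simp
    moreover have "(h has_real_derivative exp (- c * t) * (e' t - c * e t) - \<delta>) (at t)"
      using h'[of t] t at_within_Icc_at[of 0 t T] by simp
    ultimately show "\<exists>y. (h has_real_derivative y) (at t) \<and> y \<le> 0" by blast
  qed
  also have "h 0 = 0" using d0 by (simp add: h_def e_def)
  finally have "exp (- c * T) * e T \<le> \<delta> * T" by (simp add: h_def)
  hence "exp (c * T) * (exp (- c * T) * e T) \<le> exp (c * T) * (\<delta> * T)"
    by (intro mult_left_mono) auto
  moreover have "exp (c * T) * exp (- c * T) = 1"
    by (simp add: exp_minus)
  ultimately have "e T \<le> exp (c * T) * (\<delta> * T)"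
    by (simp only: mult.assoc[symmetric] mult_1_left)
  thus ?thesis
    by (simp only: e_def b_def c_def mult.commute[of _ "exp _"])
qed

lemma entire_taylor_uniform_limit:
  assumes "f holomorphic_on UNIV"
  shows "uniform_limit (cball 0 R) (\<lambda>N s. \<Sum>l<N. (deriv ^^ l) f 0 * scaled_monomial l s) f sequentially"
proof -
  define a where "a l = (deriv ^^ l) f 0 / fact l" for l
  have S: "(\<lambda>l. a l * s ^ l) sums f s" for s
    using holomorphic_power_series[of f 0 "cmod s + 1" s] assms
    by (auto simp: a_def intro: holomorphic_on_subset)
  have "conv_radius a = \<infinity>"
    by (rule conv_radius_inftyI''[OF sums_summable[OF S]])
  hence "uniform_limit (cball 0 R) (\<lambda>N s. \<Sum>l<N. a l * (s - 0) ^ l) (\<lambda>s. \<Sum>l. a l * (s - 0) ^ l) sequentially"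
    by (intro powser_uniform_limit) simp
  thus ?thesis using S by (simp add: sums_iff a_def scaled_monomial_def)
qed

theorem theorem8:
  fixes n :: nat and A :: "complex mat" and u0 :: "complex vec"
    and g :: "complex \<Rightarrow> complex vec" and u :: "real \<Rightarrow> complex vec"
  assumes "A \<in> carrier_mat n n"
    and "u0 \<in> carrier_vec n"
    and "entire_vec n g"
    and "solves_ivp n A g u0 u"
  shows "(\<forall>N\<ge>1. \<forall>t. eps_vec N t = 0\<^sub>v N) \<and>
         (\<forall>t\<ge>0. (\<lambda>N. eucl_norm (u t - trunc_sol n A g u0 N t)) \<longlonglongrightarrow> 0)"
proof (intro conjI allI impI)
  show "eps_vec N t = 0\<^sub>v N" for N t
    by (simp add: eps_vec_def mat_exp_shift_mat_unit_vec) (auto simp: monomial_vec_def)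
next
  fix T :: real assume T: "0 \<le> T"
  let ?v = "trunc_sol n A g u0"
  define d where "d N i t = u t $ i - ?v N t $ i" for N i t
  define r where "r N i t = g (of_real t) $ i - (\<Sum>l<N. taylor_coeff n g l $ i * scaled_monomial l (of_real t))"
    for N i and t :: real
  have u: "u t \<in> carrier_vec n" if "0 \<le> t" for t
    using assms(4) that by (auto simp: solves_ivp_def)
  have v: "?v N t \<in> carrier_vec n" for N t by (simp add: trunc_sol_def)
  have d0: "d N i 0 = 0" for N i
    using assms(4) trunc_sol_0[OF assms(1,2)] by (simp add: d_def solves_ivp_def)
  have deriv: "(d N i has_vector_derivative (\<Sum>j<n. A $$ (i, j) * d N j t) + r N i t) (at t within {0..T})"
    if i: "i < n" and t: "t \<in> {0..T}" for N i t
  proof -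
    have "((\<lambda>s. u s $ i) has_vector_derivative (A *\<^sub>v u t + g (of_real t)) $ i) (at t within {0..T})"
      using assms(4) i t
      by (intro has_vector_derivative_within_subset[of _ _ t "{0..}" "{0..T}"]) (auto simp: solves_ivp_def)
    from has_vector_derivative_diff[OF this
        has_vector_derivative_at_within[OF trunc_sol_has_vector_derivative[OF assms(1,2) i]]]
    have "(d N i has_vector_derivative (A *\<^sub>v u t + g (of_real t)) $ i -
        ((A *\<^sub>v ?v N t) $ i + (\<Sum>l<N. taylor_coeff n g l $ i * scaled_monomial l (of_real t))))
        (at t within {0..T})"
      unfolding d_def[abs_def] .
    moreover have "(A *\<^sub>v u t + g (of_real t)) $ i = (\<Sum>j<n. A $$ (i, j) * u t $ j) + g (of_real t) $ i"
    proof -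
      have "g (of_real t) \<in> carrier_vec n" using assms(3) by (simp add: entire_vec_def)
      thus ?thesis using assms(1) i t u[of t] by (simp add: scalar_prod_def atLeast0LessThan)
    qed
    moreover have "(A *\<^sub>v ?v N t) $ i = (\<Sum>j<n. A $$ (i, j) * ?v N t $ j)"
      using assms(1) i v[of N t] by (simp add: scalar_prod_def atLeast0LessThan)
    ultimately show ?thesis
      by (simp add: d_def r_def algebra_simps sum_subtractf)
  qed
  define K where "K = T * exp ((2 * (\<Sum>i<n. \<Sum>j<n. cmod (A $$ (i, j))) + 1) * T)"
  have K: "0 \<le> K" using T by (simp add: K_def)
  have unif: "\<forall>\<^sub>F N in sequentially. \<forall>t\<in>{0..T}. cmod (r N i t) < \<eta>" if i: "i < n" and "0 < \<eta>" for i \<eta>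
  proof -
    have "(\<lambda>s. g s $ i) holomorphic_on UNIV" using assms(3) i by (simp add: entire_vec_def)
    from uniform_limitD[OF entire_taylor_uniform_limit[OF this, of T] \<open>0 < \<eta>\<close>]
    show ?thesis
    proof eventually_elim
      case (elim N)
      show ?case
      proof
        fix t assume "t \<in> {0..T}"
        hence "complex_of_real t \<in> cball 0 T" by simp
        with elim show "cmod (r N i t) < \<eta>"
          using i by (simp add: r_def taylor_coeff_def dist_norm norm_minus_commute)
      qed
    qed
  qed
  have "(\<lambda>N. \<Sum>i<n. (cmod (d N i T))\<^sup>2) \<longlonglongrightarrow> 0"
  proof (rule tendstoI)
    fix \<epsilon> :: real assume "0 < \<epsilon>"
    \<comment> \<open>The energy bound will be \<open>n K \<eta>\<^sup>2\<close>; adding one to both factors avoids a division by zero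
      when \<open>n = 0\<close> or \<open>T = 0\<close>.\<close>
    define \<eta> where "\<eta> = sqrt (\<epsilon> / ((real n + 1) * (K + 1)))"
    have \<eta>: "0 < \<eta>" using \<open>0 < \<epsilon>\<close> K by (simp add: \<eta>_def)
    have \<eta>2: "\<eta>\<^sup>2 = \<epsilon> / ((real n + 1) * (K + 1))" using \<open>0 < \<epsilon>\<close> K by (simp add: \<eta>_def)
    have "real n * K < (real n + 1) * (K + 1)" using K by (simp add: algebra_simps)
    hence "real n * K * \<eta>\<^sup>2 < (real n + 1) * (K + 1) * \<eta>\<^sup>2"
      using \<eta> by (intro mult_strict_right_mono) auto
    also have "\<dots> = \<epsilon>" using K by (simp add: \<eta>2)
    finally have small: "real n * K * \<eta>\<^sup>2 < \<epsilon>" .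
    have "\<forall>\<^sub>F N in sequentially. \<forall>i\<in>{..<n}. \<forall>t\<in>{0..T}. cmod (r N i t) < \<eta>"
      using unif \<eta> by (intro eventually_ball_finite) auto
    thus "\<forall>\<^sub>F N in sequentially. dist (\<Sum>i<n. (cmod (d N i T))\<^sup>2) 0 < \<epsilon>"
    proof eventually_elim
      case (elim N)
      have "(\<Sum>i<n. (cmod (r N i t))\<^sup>2) \<le> real n * \<eta>\<^sup>2" if "t \<in> {0..T}" for t
        using sum_bounded_above[of "{..<n}" "\<lambda>i. (cmod (r N i t))\<^sup>2" "\<eta>\<^sup>2"] elim that
        by (force intro: power_mono less_imp_le)
      from linear_ode_energy_bound[of "{..<n}" T "d N" "\<lambda>i j. A $$ (i, j)" "r N", OF _ T deriv d0 this]
      have "(\<Sum>i<n. (cmod (d N i T))\<^sup>2) \<le> real n * K * \<eta>\<^sup>2"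
        by (simp add: K_def mult_ac)
      with small show ?case by (simp add: sum_nonneg)
    qed
  qed
  from tendsto_real_sqrt[OF this]
  have "(\<lambda>N. sqrt (\<Sum>i<n. (cmod (d N i T))\<^sup>2)) \<longlonglongrightarrow> 0" by simp
  moreover have "eucl_norm (u T - ?v N T) = sqrt (\<Sum>i<n. (cmod (d N i T))\<^sup>2)" for N
    using u[OF T] v[of N T] by (simp add: eucl_norm_def L2_set_def d_def)
  ultimately show "(\<lambda>N. eucl_norm (u T - ?v N T)) \<longlonglongrightarrow> 0" by simp
qed

end
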